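(* Let $G$ be a finite group, let $G^*$ be the group of automorphisms of the group $G$, and let $H$ be a non-trivial subgroup of $G^*$, with both $G$ and $H$ of odd order. Then there exists a game subset $A \subset G$ such that $H \subset Aut(\Gamma[A])$.
   Context: For a group $G$ of odd order with identity $e$, a game subset is a subset $A \subset G$ such that $G$ is the disjoint union $A \cup A^{-1} \cup \{e\}$, where $A^{-1} = \{a^{-1} : a\in A\}$. The associated group game is the tournament $\Gamma[A] = \{(i,j) \in G \times G : i^{-1}j \in A\}$ on $G$. $Aut(\Gamma[A])$ is the group of bijections $\rho$ of $G$ with $(i,j)\in\Gamma[A] \Leftrightarrow (\rho(i),\rho(j))\in\Gamma[A]$. *)

theory Defs
  imports "HOL-Algebra.Algebra"
begin

definition game_subset :: "('a, 'b) monoid_scheme \<Rightarrow> 'a set \<Rightarrow> bool" where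
  "game_subset G A \<longleftrightarrow>
     A \<subseteq> carrier G \<and>
     carrier G = A \<union> set_inv\<^bsub>G\<^esub> A \<union> {\<one>\<^bsub>G\<^esub>} \<and>
     A \<inter> set_inv\<^bsub>G\<^esub> A = {} \<and> \<one>\<^bsub>G\<^esub> \<notin> A \<and> \<one>\<^bsub>G\<^esub> \<notin> set_inv\<^bsub>G\<^esub> A"

definition group_game :: "('a, 'b) monoid_scheme \<Rightarrow> 'a set \<Rightarrow> ('a \<times> 'a) set" where
  "group_game G A =
     {(i, j). i \<in> carrier G \<and> j \<in> carrier G \<and> inv\<^bsub>G\<^esub> i \<otimes>\<^bsub>G\<^esub> j \<in> A}"

text \<open>The automorphism group of a digraph \<open>R\<close> on the vertex set \<open>V\<close>. As in \<^const>\<open>Bij\<close> and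
  \<^const>\<open>AutoGroup\<close>, bijections of \<open>V\<close> are represented by functions that are extensional
  on \<open>V\<close>, so the elements of both automorphism groups can be compared directly.\<close>

definition digraph_auto :: "'a set \<Rightarrow> ('a \<times> 'a) set \<Rightarrow> ('a \<Rightarrow> 'a) set" where
  "digraph_auto V R =
     {\<rho> \<in> Bij V. \<forall>i\<in>V. \<forall>j\<in>V. (i, j) \<in> R \<longleftrightarrow> (\<rho> i, \<rho> j) \<in> R}"

definition digraph_AutoGroup :: "'a set \<Rightarrow> ('a \<times> 'a) set \<Rightarrow> ('a \<Rightarrow> 'a) monoid" where
  "digraph_AutoGroup V R = BijGroup V \<lparr>carrier := digraph_auto V R\<rparr>"

end

theory Submission
  imports Defs
begin

text \<open>A subset \<open>A\<close> invariant under \<open>H\<close> makes every element of \<open>H\<close> an automorphism of the game, so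
  it suffices to select, from each pair consisting of the \<open>H\<close>-orbits of \<open>x \<noteq> \<one>\<close> and of \<open>x\<close> inverted,
  exactly one orbit. The two orbits are distinct: an \<open>h \<in> H\<close> that inverts \<open>x\<close> also inverts it in
  its \<open>card H\<close>-th power, which is the identity as \<open>card H\<close> is odd; thus \<open>x\<close> is its own inverse,
  which is impossible in a group of odd order.\<close>

text \<open>The powers of an element with square \<open>\<one>\<close> alternate between
  \<open>\<one>\<close> and the element; the exponent \<open>order G\<close> is odd, yet gives
  \<open>\<one>\<close>.\<close>

lemma (in group) self_inv_eq_one:
  assumes "odd (order G)" "x \<in> carrier G" "inv x = x"
  shows "x = \<one>"
proof -
  have sq: "x \<otimes> x = \<one>"
    using assms by (metis r_inv)
  have "x [^] n = (if even n then \<one> else x)" for n :: nat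
    using assms(2) sq by (induction n) auto
  from this[of "order G"] show ?thesis
    using assms pow_order_eq_1[OF assms(2)] by simp
qed

locale automorphism_subgroup = group G for G (structure) +
  fixes H
  assumes subgroup_H: "subgroup H (AutoGroup G)"
begin

definition orb :: "'a \<Rightarrow> 'a set" where
  "orb x = (\<lambda>h. h x) ` H"

lemma mem_auto:
  assumes "h \<in> H"
  shows "h \<in> hom G G" "h \<in> Bij (carrier G)"
  using subgroup.mem_carrier[OF subgroup_H assms] by (auto simp: AutoGroup_def auto_def)

lemma mem_closed: "h \<in> H \<Longrightarrow> x \<in> carrier G \<Longrightarrow> h x \<in> carrier G"
  using mem_auto(1) hom_in_carrier by metis

lemma mem_inv: "h \<in> H \<Longrightarrow> x \<in> carrier G \<Longrightarrow> h (inv x) = inv (h x)"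
  using mem_auto(1) by (simp add: group_hom.hom_inv group_hom_axioms.intro group_hom_def is_group)

lemma mult_apply:
  assumes "g \<in> H" "h \<in> H" "x \<in> carrier G"
  shows "(g \<otimes>\<^bsub>AutoGroup G\<^esub> h) x = g (h x)"
  using assms mem_auto(2) by (simp add: AutoGroup_def BijGroup_def compose_def)

lemma one_apply: "x \<in> carrier G \<Longrightarrow> \<one>\<^bsub>AutoGroup G\<^esub> x = x"
  by (simp add: AutoGroup_def BijGroup_def)

lemma self_mem_orb: "x \<in> carrier G \<Longrightarrow> x \<in> orb x"
  unfolding orb_def using one_apply subgroup.one_closed[OF subgroup_H]
  by (intro image_eqI[of _ _ "\<one>\<^bsub>AutoGroup G\<^esub>"]) simp_all

lemma orb_apply_subset:
  assumes "h \<in> H" "x \<in> carrier G"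
  shows "orb (h x) \<subseteq> orb x"
  unfolding orb_def
proof (rule image_subsetI)
  fix g assume "g \<in> H"
  then show "g (h x) \<in> (\<lambda>h. h x) ` H"
    using assms mult_apply subgroup.m_closed[OF subgroup_H]
    by (intro image_eqI[of _ _ "g \<otimes>\<^bsub>AutoGroup G\<^esub> h"]) auto
qed

text \<open>\<open>x\<close> is itself the image of \<open>h x\<close> under the inverse of
  \<open>h\<close>, so \<open>orb_apply_subset\<close> yields both inclusions.\<close>

lemma orb_apply:
  assumes "h \<in> H" "x \<in> carrier G"
  shows "orb (h x) = orb x"
proof -
  let ?g = "inv\<^bsub>AutoGroup G\<^esub> h"
  have g: "?g \<in> H"
    using assms subgroup.m_inv_closed[OF subgroup_H] by blast
  have "?g (h x) = (?g \<otimes>\<^bsub>AutoGroup G\<^esub> h) x"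
    using mult_apply g assms by simp
  also have "\<dots> = x"
    using assms one_apply group.l_inv[OF AutoGroup] subgroup.mem_carrier[OF subgroup_H] by simp
  finally show ?thesis
    using orb_apply_subset assms g mem_closed by (metis subset_antisym)
qed

lemma mem_pow_card:
  assumes "h \<in> H"
  shows "h [^]\<^bsub>AutoGroup G\<^esub> card H = \<one>\<^bsub>AutoGroup G\<^esub>"
proof -
  let ?K = "AutoGroup G\<lparr>carrier := H\<rparr>"
  have "h [^]\<^bsub>?K\<^esub> order ?K = \<one>\<^bsub>?K\<^esub>"
    using subgroup.subgroup_is_group[OF subgroup_H AutoGroup] assms
    by (intro group.pow_order_eq_1) auto
  then show ?thesis
    \<comment> \<open>Restricting the carrier changes neither the unit nor the powers.\<close>
    by (simp add: order_def nat_pow_def)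
qed

lemma inverts_imp_self_inv:
  assumes "odd (card H)" "h \<in> H" "x \<in> carrier G" "h x = inv x"
  shows "inv x = x"
proof -
  interpret A: group "AutoGroup G"
    by (rule AutoGroup)
  have mem: "h [^]\<^bsub>AutoGroup G\<^esub> n \<in> H" for n :: nat
    using assms(2) subgroup_H
    by (induction n) (auto intro: subgroup.m_closed subgroup.one_closed)
  have hinv: "h (inv x) = x"
    using assms mem_inv inv_inv by metis
  \<comment> \<open>The two claims need a joint induction: a successor power splits off
    \<open>h\<close> on the right, and \<open>h x = inv x\<close>, so the step for \<open>x\<close>
    uses the hypothesis at \<open>inv x\<close> and vice versa.\<close>
  have "(h [^]\<^bsub>AutoGroup G\<^esub> n) x = (if even n then x else inv x) \<and>
        (h [^]\<^bsub>AutoGroup G\<^esub> n) (inv x) = (if even n then inv x else x)" for n :: nat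
    using assms hinv mem by (induction n) (auto simp: one_apply mult_apply)
  from this[of "card H"] show ?thesis
    using assms one_apply mem_pow_card by simp
qed

lemma orb_inv_neq:
  assumes "odd (order G)" "odd (card H)" "x \<in> carrier G" "x \<noteq> \<one>"
  shows "orb (inv x) \<noteq> orb x"
proof
  assume "orb (inv x) = orb x"
  then have "inv x \<in> orb x"
    using self_mem_orb[of "inv x"] assms(3) by simp
  then obtain h where "h \<in> H" "h x = inv x"
    unfolding orb_def by force
  then show False
    using assms inverts_imp_self_inv self_inv_eq_one by blast
qed

lemma ex_invariant_game_subset:
  assumes "odd (order G)" "odd (card H)"
  shows "\<exists>A. game_subset G A \<and> (\<forall>h\<in>H. \<forall>x\<in>carrier G. h x \<in> A \<longleftrightarrow> x \<in> A)"
proof -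
  \<comment> \<open>\<open>SOME\<close> sees only the unordered pair of orbits, so the choice is the
    same for \<open>x\<close>, for \<open>inv x\<close> and for all images of \<open>x\<close> under
    \<open>H\<close>.\<close>
  define choice where "choice x = (SOME Q. Q \<in> {orb x, orb (inv x)})" for x
  \<comment> \<open>The identity is excluded explicitly: both its orbits coincide, so it would
    always pass the test on \<open>choice\<close>.\<close>
  define A where "A = {x \<in> carrier G. x \<noteq> \<one> \<and> choice x = orb x}"
  have choice: "choice x = orb x \<or> choice x = orb (inv x)" for x
    unfolding choice_def using someI[of "\<lambda>Q. Q \<in> {orb x, orb (inv x)}" "orb x"] by simp
  have choice_inv: "choice (inv x) = choice x" if "x \<in> carrier G" for x
    using that by (simp add: choice_def insert_commute disj_commute)
  have choice_apply: "choice (h x) = choice x" if "h \<in> H" "x \<in> carrier G" for h x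
    using that by (simp add: choice_def orb_apply flip: mem_inv)
  \<comment> \<open>The common choice for \<open>x\<close> and \<open>inv x\<close> equals exactly
    one of their two distinct orbits.\<close>
  have inv_mem: "inv x \<in> A \<longleftrightarrow> x \<notin> A" if "x \<in> carrier G" "x \<noteq> \<one>" for x
    using that choice[of x] choice_inv orb_inv_neq[OF assms that] by (auto simp: A_def)
  have sub: "A \<subseteq> carrier G" "\<one> \<notin> A"
    by (auto simp: A_def)
  have mem_set_inv: "y \<in> set_inv A \<longleftrightarrow> y \<in> carrier G \<and> inv y \<in> A" for y
    unfolding SET_INV_def using sub(1) by (auto intro!: bexI[of _ "inv y"])
  have "game_subset G A"
    unfolding game_subset_def
  proof (intro conjI)
    show "carrier G = A \<union> set_inv A \<union> {\<one>}"
    proof (rule Set.set_eqI)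
      fix y
      show "y \<in> carrier G \<longleftrightarrow> y \<in> A \<union> set_inv A \<union> {\<one>}"
        using sub(1) inv_mem[of y] by (cases "y = \<one>") (auto simp: mem_set_inv)
    qed
    show "A \<inter> set_inv A = {}"
    proof (rule equals0I)
      fix y
      assume "y \<in> A \<inter> set_inv A"
      then have "y \<in> A" "inv y \<in> A"
        by (simp_all add: mem_set_inv)
      then show False
        using sub inv_mem[of y] by (cases "y = \<one>") auto
    qed
  qed (use sub in \<open>simp_all add: mem_set_inv\<close>)
  moreover have "h x \<in> A \<longleftrightarrow> x \<in> A" if "h \<in> H" "x \<in> carrier G" for h x
  proof -
    \<comment> \<open>Since \<open>A\<close> leaves out \<open>\<one>\<close>, its invariance also
      requires that \<open>h\<close> send no other element to \<open>\<one>\<close>.\<close>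
    have "h \<one> = \<one>"
      using mem_auto(1)[OF that(1)] is_group hom_one by blast
    moreover have "inj_on h (carrier G)"
      using mem_auto(2)[OF that(1)] by (simp add: Bij_def bij_betw_def)
    ultimately have "h x = \<one> \<longleftrightarrow> x = \<one>"
      using that(2) by (metis inj_on_eq_iff one_closed)
    then show ?thesis
      using that by (simp add: A_def mem_closed orb_apply choice_apply)
  qed
  ultimately show ?thesis
    by blast
qed

text \<open>Whether \<open>(i, j)\<close> is an arc depends only on
  \<open>inv i \<otimes> j\<close>, and the homomorphism \<open>h\<close> carries this quotient to
  that of the images.\<close>

lemma invariant_imp_digraph_auto:
  assumes "h \<in> H" "\<And>x. x \<in> carrier G \<Longrightarrow> h x \<in> A \<longleftrightarrow> x \<in> A"
  shows "h \<in> digraph_auto (carrier G) (group_game G A)"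
proof -
  have "inv (h i) \<otimes> h j = h (inv i \<otimes> j)" if "i \<in> carrier G" "j \<in> carrier G" for i j
    using that assms(1) mem_auto(1) hom_mult[of h G G "inv i" j] by (simp add: mem_inv)
  then show ?thesis
    using assms mem_auto(2) by (simp add: digraph_auto_def group_game_def mem_closed)
qed

end

theorem theorem3p14:
  fixes G :: "('a, 'b) monoid_scheme" and H :: "('a \<Rightarrow> 'a) set"
  assumes "group G" and "finite (carrier G)" and "odd (order G)"
    and "subgroup H (AutoGroup G)" and "H \<noteq> {\<one>\<^bsub>AutoGroup G\<^esub>}" and "odd (card H)"
  shows "\<exists>A. game_subset G A \<and>
           H \<subseteq> carrier (digraph_AutoGroup (carrier G) (group_game G A))"
proof -
  interpret automorphism_subgroup G H
    using assms by (simp add: automorphism_subgroup_def automorphism_subgroup_axioms_def)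
  obtain A where "game_subset G A" "\<forall>h\<in>H. \<forall>x\<in>carrier G. h x \<in> A \<longleftrightarrow> x \<in> A"
    using ex_invariant_game_subset assms by blast
  then show ?thesis
    using invariant_imp_digraph_auto by (auto simp: digraph_AutoGroup_def)
qed

end
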